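(* Let $V$ be a valuation domain. The generalized Ratliff-Rush closure $I\mapsto\hat{I}$ on nonzero fractional ideals of $V$ is a star operation on $V$ if and only if each nonzero nonmaximal prime ideal $P$ of $V$ is not idempotent (i.e. $P^2\neq P$). In this case, it coincides with the $v$-operation, that is, $\hat{I}=I_v$ for every nonzero fractional ideal $I$ of $V$.
   Context: Let $R$ be an integral domain with quotient field $K$, and let $F(R)$ be the set of nonzero fractional ideals of $R$. For $I\in F(R)$, the generalized Ratliff-Rush closure of $I$ is $\hat{I}=\{x\in K : xI^n\subseteq I^{n+1}\text{ for some } n\ge 1\}$ (when $R$ is a valuation domain, $\hat{I}$ is always a fractional ideal). For $I\in F(R)$, $I^{-1}=\{x\in K : xI\subseteq R\}$ and $I_v=(I^{-1})^{-1}$; the $v$-operation is $I\mapsto I_v$. A star operation on $R$ is a map $*:F(R)\to F(R)$, $E\mapsto E^*$, such that for all $E,F\in F(R)$ and all $0\neq a\in K$: (E1) $R^*=R$ and $(aE)^*=aE^*$; (E2) $E\subseteq E^*$, and if $E\subseteq F$ then $E^*\subseteq F^*$; (E3) $E^{**}=E^*$. Here $R=V$. *)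

theory Defs
  imports "HOL-Algebra.Algebra"
begin

text \<open>
  An integral domain is given together with its quotient field, as a subring V of the field K;
  as a ring in its own right it is \<open>K\<lparr>carrier := V\<rparr>\<close>.
\<close>

locale domain_in_quotient_field = field K + subring V K for V and K (structure) +
  assumes quotient: "x \<in> carrier K \<Longrightarrow> \<exists>a \<in> V. \<exists>b \<in> V - {\<zero>}. x = a \<otimes> inv b"

locale valuation_domain = domain_in_quotient_field +
  assumes valuation: "x \<in> carrier K - {\<zero>} \<Longrightarrow> x \<in> V \<or> inv x \<in> V"

definition fractional_ideals :: "'a set \<Rightarrow> ('a, 'b) ring_scheme \<Rightarrow> 'a set set" where
  "fractional_ideals V K =
     {I. additive_subgroup I K \<and> (\<forall>r \<in> V. \<forall>x \<in> I. r \<otimes>\<^bsub>K\<^esub> x \<in> I) \<and> I \<noteq> {\<zero>\<^bsub>K\<^esub>} \<and>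
         (\<exists>d \<in> V - {\<zero>\<^bsub>K\<^esub>}. d <#\<^bsub>K\<^esub> I \<subseteq> V)}"

text \<open>
  \<open>ideal_prod K I J\<close> is the set of finite nonempty sums of products of an element of I and an
  element of J. Its definition does not require I and J to be ideals of K, so it is also
  the product of fractional ideals.
\<close>

primrec ideal_pow :: "'a set \<Rightarrow> ('a, 'b) ring_scheme \<Rightarrow> 'a set \<Rightarrow> nat \<Rightarrow> 'a set" where
  "ideal_pow V K I 0 = V"
| "ideal_pow V K I (Suc n) = ideal_prod K I (ideal_pow V K I n)"

definition ratliff_rush :: "'a set \<Rightarrow> ('a, 'b) ring_scheme \<Rightarrow> 'a set \<Rightarrow> 'a set" where
  "ratliff_rush V K I =
     {x \<in> carrier K. \<exists>n \<ge> 1. x <#\<^bsub>K\<^esub> ideal_pow V K I n \<subseteq> ideal_pow V K I (n + 1)}"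

definition frac_inv :: "'a set \<Rightarrow> ('a, 'b) ring_scheme \<Rightarrow> 'a set \<Rightarrow> 'a set" where
  "frac_inv V K I = {x \<in> carrier K. x <#\<^bsub>K\<^esub> I \<subseteq> V}"

definition v_closure :: "'a set \<Rightarrow> ('a, 'b) ring_scheme \<Rightarrow> 'a set \<Rightarrow> 'a set" where
  "v_closure V K I = frac_inv V K (frac_inv V K I)"

text \<open>Only the values of \<open>star\<close> on nonzero fractional ideals are relevant.\<close>

definition star_operation ::
    "'a set \<Rightarrow> ('a, 'b) ring_scheme \<Rightarrow> ('a set \<Rightarrow> 'a set) \<Rightarrow> bool" where
  "star_operation V K star \<longleftrightarrow>
     star \<in> fractional_ideals V K \<rightarrow> fractional_ideals V K \<and>
     star V = V \<and>
     (\<forall>a \<in> carrier K - {\<zero>\<^bsub>K\<^esub>}. \<forall>E \<in> fractional_ideals V K.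
        star (a <#\<^bsub>K\<^esub> E) = a <#\<^bsub>K\<^esub> star E) \<and>
     (\<forall>E \<in> fractional_ideals V K. E \<subseteq> star E) \<and>
     (\<forall>E \<in> fractional_ideals V K. \<forall>F \<in> fractional_ideals V K. E \<subseteq> F \<longrightarrow> star E \<subseteq> star F) \<and>
     (\<forall>E \<in> fractional_ideals V K. star (star E) = star E)"

end

theory Submission
  imports Defs
begin

text \<open>
  Let \<open>M\<close> be the maximal ideal of the valuation domain \<open>V\<close>, and write \<open>rr I\<close> for the generalized
  Ratliff-Rush closure of \<open>I\<close>. Both \<open>rr I\<close> and \<open>I\<^sub>v\<close> contain \<open>I\<close>, so the two are compared through
  the elements that they add.

  If \<open>x\<close> lies in \<open>I\<^sub>v\<close> but not in \<open>I\<close>, then \<open>I\<close> is contained in \<open>xM\<close>, and a smaller ideal than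
  \<open>xM\<close>, or a principal \<open>M\<close>, would put \<open>I\<close> and hence \<open>I\<^sub>v\<close> inside \<open>xmV\<close> for some \<open>m\<close> in \<open>M\<close>. Hence
  \<open>I = xM\<close> and \<open>M\<^sup>2 = M\<close> (\<open>v_closure_new_element\<close>).

  If \<open>x\<close> lies in \<open>rr I\<close> but not in \<open>I\<close>, then \<open>J = x\<^sup>-\<^sup>1I\<close> is contained in \<open>M\<close> and its powers become
  stationary. The stationary power is a nonzero proper idempotent ideal, and such an ideal of a
  valuation domain is prime (\<open>idempotent_imp_primeideal\<close>). If no nonzero nonmaximal prime is
  idempotent, this power is \<open>M\<close>; as it is contained in \<open>J\<close>, again \<open>I = xM\<close> and \<open>M\<^sup>2 = M\<close>
  (\<open>ratliff_rush_new_element\<close>). Conversely, if \<open>M\<^sup>2 = M\<close>, then \<open>x\<close> belongs to both closures of \<open>xM\<close>.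
  Therefore \<open>rr I = I\<^sub>v\<close> for all \<open>I\<close>, and the v-operation is a star operation on every domain
  (\<open>v_closure_star_operation\<close>).

  For the other direction, let \<open>P\<close> be a nonmaximal idempotent prime and \<open>m\<close> an element of \<open>M\<close>
  outside \<open>P\<close>. Then \<open>m\<^sup>-\<^sup>1P\<close> is contained in \<open>P = P\<^sup>2\<close>, so \<open>rr P\<close> contains \<open>m\<^sup>-\<^sup>1\<close>, which is not in
  \<open>V\<close>; but a star operation maps the subset \<open>P\<close> of \<open>V\<close> into \<open>V\<close>
  (\<open>idempotent_prime_ratliff_rush_not_subset\<close>).
\<close>

section \<open>Submodules of the quotient field and fractional ideals\<close>

context domain_in_quotient_field
begin

text \<open>
  The \<open>V\<close>-submodules of the quotient field. These include the zero module and unbounded modules such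
  as the field itself; integral ideals and fractional ideals are special cases.
\<close>

definition submod :: "'a set \<Rightarrow> bool" where
  "submod I \<longleftrightarrow> additive_subgroup I K \<and> (\<forall>r \<in> V. \<forall>x \<in> I. r \<otimes> x \<in> I)"

lemma V_carrier: "x \<in> V \<Longrightarrow> x \<in> carrier K"
  and V_zero: "\<zero> \<in> V"
  and V_one: "\<one> \<in> V"
  and V_add: "x \<in> V \<Longrightarrow> y \<in> V \<Longrightarrow> x \<oplus> y \<in> V"
  and V_mult: "x \<in> V \<Longrightarrow> y \<in> V \<Longrightarrow> x \<otimes> y \<in> V"
  and V_minus: "x \<in> V \<Longrightarrow> \<ominus> x \<in> V"
  using subringE[OF subring_axioms] by auto

lemma inv_nonzero:
  assumes "x \<in> carrier K" "x \<noteq> \<zero>"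
  shows "inv x \<in> carrier K" "x \<otimes> inv x = \<one>" "inv x \<otimes> x = \<one>" "inv x \<noteq> \<zero>"
proof -
  have u: "x \<in> Units K" using assms field_Units by blast
  show 1: "inv x \<in> carrier K" "x \<otimes> inv x = \<one>" "inv x \<otimes> x = \<one>" using u by auto
  show "inv x \<noteq> \<zero>" using 1(2) assms(1) r_null one_not_zero by metis
qed

lemma inv_mult_cancel:
  assumes "x \<in> carrier K" "x \<noteq> \<zero>" "y \<in> carrier K"
  shows "inv x \<otimes> (x \<otimes> y) = y" "x \<otimes> (inv x \<otimes> y) = y"
  using assms inv_nonzero[OF assms(1,2)] by (simp_all add: m_assoc[symmetric])

lemma l_coset_subset_iff: "a <# I \<subseteq> J \<longleftrightarrow> (\<forall>i \<in> I. a \<otimes> i \<in> J)"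
  by (auto simp: l_coset_def)

text \<open>Closure under negation need not be checked, since \<open>- x = (- 1) x\<close>.\<close>

lemma submodI:
  assumes "I \<subseteq> carrier K" "\<zero> \<in> I" "\<And>x y. x \<in> I \<Longrightarrow> y \<in> I \<Longrightarrow> x \<oplus> y \<in> I"
    and sc: "\<And>r x. r \<in> V \<Longrightarrow> x \<in> I \<Longrightarrow> r \<otimes> x \<in> I"
  shows "submod I"
proof -
  have "\<ominus> x \<in> I" if "x \<in> I" for x
  proof -
    have "\<ominus> x = (\<ominus> \<one>) \<otimes> x" using that assms(1) by (simp add: l_minus subsetD)
    then show ?thesis using sc[OF V_minus[OF V_one] that] by simp
  qed
  then have "subgroup I (add_monoid K)"
    using assms by (intro add.subgroupI) (auto simp: a_inv_def)
  then show ?thesis unfolding submod_def using sc by (auto intro: additive_subgroup.intro)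
qed

lemma submodD:
  assumes "submod I"
  shows "x \<in> I \<Longrightarrow> x \<in> carrier K"
    and "\<zero> \<in> I"
    and "x \<in> I \<Longrightarrow> y \<in> I \<Longrightarrow> x \<oplus> y \<in> I"
    and "r \<in> V \<Longrightarrow> x \<in> I \<Longrightarrow> r \<otimes> x \<in> I"
proof -
  interpret additive_subgroup I K using assms by (simp add: submod_def)
  show "x \<in> I \<Longrightarrow> x \<in> carrier K" "\<zero> \<in> I" "x \<in> I \<Longrightarrow> y \<in> I \<Longrightarrow> x \<oplus> y \<in> I"
    using a_subset by auto
  show "r \<in> V \<Longrightarrow> x \<in> I \<Longrightarrow> r \<otimes> x \<in> I" using assms by (simp add: submod_def)
qed

lemma submod_V: "submod V"
  by (rule submodI) (auto simp: V_carrier V_zero V_add V_mult)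

lemma submod_l_coset:
  assumes a: "a \<in> carrier K" and I: "submod I"
  shows "submod (a <# I)"
proof (rule submodI)
  show "a <# I \<subseteq> carrier K" using a submodD(1)[OF I] by (auto simp: l_coset_def)
  show "\<zero> \<in> a <# I" using a submodD(2)[OF I] by (force simp: l_coset_def)
  show "x \<oplus> y \<in> a <# I" if xy: "x \<in> a <# I" "y \<in> a <# I" for x y
  proof -
    obtain i j where "i \<in> I" "j \<in> I" "x = a \<otimes> i" "y = a \<otimes> j"
      using xy by (auto simp: l_coset_def)
    then have "x \<oplus> y = a \<otimes> (i \<oplus> j)" "i \<oplus> j \<in> I"
      using a submodD[OF I] by (auto simp: r_distr)
    then show ?thesis by (auto simp: l_coset_def)
  qed
  show "r \<otimes> x \<in> a <# I" if r: "r \<in> V" and x: "x \<in> a <# I" for r x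
  proof -
    obtain i where "i \<in> I" "x = a \<otimes> i" using x by (auto simp: l_coset_def)
    then have "r \<otimes> x = a \<otimes> (r \<otimes> i)" "r \<otimes> i \<in> I"
      using a r submodD[OF I] by (auto simp: m_lcomm V_carrier)
    then show ?thesis by (auto simp: l_coset_def)
  qed
qed

lemma l_coset_inv_cancel:
  assumes "x \<in> carrier K" "x \<noteq> \<zero>" "I \<subseteq> carrier K"
  shows "x <# (inv x <# I) = I" "inv x <# (x <# I) = I"
proof -
  have "x \<otimes> (inv x \<otimes> i) = i" "inv x \<otimes> (x \<otimes> i) = i" if "i \<in> I" for i
    using inv_mult_cancel[OF assms(1,2)] that assms(3) by auto
  then show "x <# (inv x <# I) = I" "inv x <# (x <# I) = I"
    by (auto simp: l_coset_def)
qed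

lemma fractional_ideals_iff:
  "I \<in> fractional_ideals V K \<longleftrightarrow>
     submod I \<and> I \<noteq> {\<zero>} \<and> (\<exists>d \<in> V - {\<zero>}. \<forall>i \<in> I. d \<otimes> i \<in> V)"
  unfolding fractional_ideals_def submod_def l_coset_subset_iff by blast

lemma submod_nonzero_element:
  assumes "submod I" "I \<noteq> {\<zero>}"
  obtains x where "x \<in> I" "x \<noteq> \<zero>" "x \<in> carrier K"
  using assms submodD(1,2)[OF assms(1)] by blast

lemma integral_submod_fractional:
  assumes "submod I" "I \<noteq> {\<zero>}" "I \<subseteq> V"
  shows "I \<in> fractional_ideals V K"
  unfolding fractional_ideals_iff using assms V_one V_carrier by (auto intro!: bexI[of _ \<one>])

lemma V_fractional: "V \<in> fractional_ideals V K"
  using integral_submod_fractional[OF submod_V] V_one one_not_zero by blast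

text \<open>Each element of the quotient field has a nonzero denominator in \<open>V\<close>.\<close>

lemma fraction:
  assumes "x \<in> carrier K"
  obtains b where "b \<in> V" "b \<noteq> \<zero>" "b \<otimes> x \<in> V"
proof -
  obtain a b where ab: "a \<in> V" "b \<in> V - {\<zero>}" "x = a \<otimes> inv b" using quotient[OF assms] by auto
  then have "b \<otimes> x = a" using inv_nonzero[of b] by (simp add: V_carrier m_lcomm)
  then show thesis using that[of b] ab(1,2) by simp
qed

lemma fractional_l_coset:
  assumes a: "a \<in> carrier K" "a \<noteq> \<zero>" and I: "I \<in> fractional_ideals V K"
  shows "a <# I \<in> fractional_ideals V K"
proof -
  have s: "submod I" and ne: "I \<noteq> {\<zero>}" using I fractional_ideals_iff by auto
  obtain d where d: "d \<in> V - {\<zero>}" "\<And>i. i \<in> I \<Longrightarrow> d \<otimes> i \<in> V"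
    using I fractional_ideals_iff by auto
  obtain x where x: "x \<in> I" "x \<noteq> \<zero>" "x \<in> carrier K" using submod_nonzero_element[OF s ne] .
  have "a \<otimes> x \<noteq> \<zero>" "a \<otimes> x \<in> a <# I" using a x by (auto simp: l_coset_def integral_iff)
  then have 1: "a <# I \<noteq> {\<zero>}" by auto
  obtain b where b: "b \<in> V" "b \<noteq> \<zero>" "b \<otimes> a \<in> V" using fraction[OF a(1)] .
  have "(b \<otimes> d) \<otimes> (a \<otimes> i) \<in> V" if "i \<in> I" for i
  proof -
    have "(b \<otimes> d) \<otimes> (a \<otimes> i) = (b \<otimes> a) \<otimes> (d \<otimes> i)"
      using a b d(1) submodD(1)[OF s that] by (simp add: V_carrier m_ac)
    then show ?thesis using b d(2)[OF that] V_mult by auto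
  qed
  moreover have "b \<otimes> d \<in> V - {\<zero>}" using b d(1) V_carrier V_mult by (auto simp: integral_iff)
  ultimately have "\<exists>e \<in> V - {\<zero>}. \<forall>i \<in> a <# I. e \<otimes> i \<in> V" by (auto simp: l_coset_def)
  then show ?thesis unfolding fractional_ideals_iff using submod_l_coset[OF a(1) s] 1 by blast
qed


section \<open>The v-operation is a star operation\<close>

lemma frac_inv_iff: "x \<in> frac_inv V K I \<longleftrightarrow> x \<in> carrier K \<and> (\<forall>i \<in> I. x \<otimes> i \<in> V)"
  by (auto simp: frac_inv_def l_coset_def)

lemma frac_inv_antimono: "I \<subseteq> J \<Longrightarrow> frac_inv V K J \<subseteq> frac_inv V K I"
  unfolding subset_iff frac_inv_iff by blast

lemma subset_v_closure: "I \<subseteq> carrier K \<Longrightarrow> I \<subseteq> v_closure V K I"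
  by (fastforce simp: v_closure_def frac_inv_iff m_comm)

lemma frac_inv_fractional:
  assumes "I \<in> fractional_ideals V K"
  shows "frac_inv V K I \<in> fractional_ideals V K"
proof -
  have s: "submod I" and ne: "I \<noteq> {\<zero>}" using assms fractional_ideals_iff by auto
  obtain d where d: "d \<in> V - {\<zero>}" "\<And>i. i \<in> I \<Longrightarrow> d \<otimes> i \<in> V"
    using assms fractional_ideals_iff by auto
  have "submod (frac_inv V K I)"
  proof (rule submodI)
    show "frac_inv V K I \<subseteq> carrier K" "\<zero> \<in> frac_inv V K I"
      using submodD(1)[OF s] V_zero by (auto simp: frac_inv_iff)
    show "x \<oplus> y \<in> frac_inv V K I" if "x \<in> frac_inv V K I" "y \<in> frac_inv V K I" for x y
      using that submodD(1)[OF s] by (auto simp: frac_inv_iff l_distr V_add)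
    show "r \<otimes> x \<in> frac_inv V K I" if "r \<in> V" "x \<in> frac_inv V K I" for r x
      using that submodD(1)[OF s] by (auto simp: frac_inv_iff m_assoc V_mult V_carrier)
  qed
  moreover have "d \<in> frac_inv V K I" using d V_carrier by (auto simp: frac_inv_iff)
  then have "frac_inv V K I \<noteq> {\<zero>}" using d by auto
  moreover have "\<exists>e \<in> V - {\<zero>}. \<forall>y \<in> frac_inv V K I. e \<otimes> y \<in> V"
  proof -
    obtain x where x: "x \<in> I" "x \<noteq> \<zero>" "x \<in> carrier K" using submod_nonzero_element[OF s ne] .
    \<comment> \<open>Any nonzero element of \<open>I \<inter> V\<close> is a common denominator of the inverse of \<open>I\<close>.\<close>
    obtain b where b: "b \<in> V" "b \<noteq> \<zero>" "b \<otimes> x \<in> V" using fraction[OF x(3)] .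
    have "b \<otimes> x \<in> I" using submodD(4)[OF s b(1) x(1)] .
    moreover have "b \<otimes> x \<noteq> \<zero>" using b x V_carrier by (simp add: integral_iff)
    ultimately show ?thesis using b(3) V_carrier
      by (intro bexI[of _ "b \<otimes> x"]) (auto simp: frac_inv_iff m_comm)
  qed
  ultimately show ?thesis unfolding fractional_ideals_iff by auto
qed

lemma frac_inv_l_coset:
  assumes a: "a \<in> carrier K" "a \<noteq> \<zero>" and I: "I \<subseteq> carrier K"
  shows "frac_inv V K (a <# I) = inv a <# frac_inv V K I"
proof (intro equalityI subsetI)
  fix x assume x: "x \<in> frac_inv V K (a <# I)"
  then have xc: "x \<in> carrier K" by (simp add: frac_inv_iff)
  have "(a \<otimes> x) \<otimes> i \<in> V" if "i \<in> I" for i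
  proof -
    have "(a \<otimes> x) \<otimes> i = x \<otimes> (a \<otimes> i)" using a xc that I by (simp add: m_ac subset_iff)
    then show ?thesis using x that by (auto simp: frac_inv_iff l_coset_def)
  qed
  then have "a \<otimes> x \<in> frac_inv V K I" using a xc by (auto simp: frac_inv_iff)
  then show "x \<in> inv a <# frac_inv V K I"
    using inv_mult_cancel(1)[OF a xc] by (force simp: l_coset_def)
next
  fix x assume "x \<in> inv a <# frac_inv V K I"
  then obtain y where y: "y \<in> frac_inv V K I" "x = inv a \<otimes> y" by (auto simp: l_coset_def)
  then have yc: "y \<in> carrier K" by (simp add: frac_inv_iff)
  have "x \<otimes> (a \<otimes> i) = y \<otimes> i" if "i \<in> I" for i
  proof -
    have ic: "i \<in> carrier K" using that I by auto
    have "x \<otimes> (a \<otimes> i) = y \<otimes> (inv a \<otimes> (a \<otimes> i))"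
      using a inv_nonzero[OF a] yc ic y(2) by (simp add: m_ac)
    then show ?thesis using inv_mult_cancel[OF a ic] by simp
  qed
  then show "x \<in> frac_inv V K (a <# I)"
    using y inv_nonzero[OF a] yc by (auto simp: frac_inv_iff l_coset_def)
qed

lemma frac_inv_V: "frac_inv V K V = V"
proof (intro equalityI subsetI)
  fix x assume "x \<in> frac_inv V K V"
  then have "x \<in> carrier K" "x \<otimes> \<one> \<in> V" using V_one unfolding frac_inv_iff by blast+
  then show "x \<in> V" by simp
next
  fix x assume "x \<in> V"
  then show "x \<in> frac_inv V K V" by (simp add: frac_inv_iff V_carrier[of x] V_mult[of x])
qed

lemma fractional_subset_carrier: "I \<in> fractional_ideals V K \<Longrightarrow> I \<subseteq> carrier K"
  using submodD(1)[of I] by (simp add: fractional_ideals_iff subset_iff)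

lemma v_closure_star_operation: "star_operation V K (v_closure V K)"
  unfolding star_operation_def
proof (intro conjI ballI impI)
  show "v_closure V K \<in> fractional_ideals V K \<rightarrow> fractional_ideals V K"
    by (rule Pi_I) (simp add: v_closure_def frac_inv_fractional)
  show "v_closure V K V = V" by (simp add: v_closure_def frac_inv_V)
next
  fix a E assume a: "a \<in> carrier K - {\<zero>}" and E: "E \<in> fractional_ideals V K"
  then have ac: "a \<in> carrier K" "a \<noteq> \<zero>" by auto
  have "inv (inv a) = a" using a field_Units by auto
  moreover have "frac_inv V K E \<subseteq> carrier K" by (auto simp: frac_inv_iff)
  ultimately show "v_closure V K (a <# E) = a <# v_closure V K E"
    unfolding v_closure_def
    using frac_inv_l_coset[OF ac fractional_subset_carrier[OF E]]
      frac_inv_l_coset[OF inv_nonzero(1,4)[OF ac]] by simp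
next
  fix E assume E: "E \<in> fractional_ideals V K"
  then show sub: "E \<subseteq> v_closure V K E" by (intro subset_v_closure fractional_subset_carrier)
  \<comment> \<open>The inverse of \<open>E\<close> is already v-closed.\<close>
  have "frac_inv V K (v_closure V K E) = frac_inv V K E"
  proof (rule equalityI[OF frac_inv_antimono[OF sub]])
    have "frac_inv V K E \<subseteq> carrier K" by (auto simp: frac_inv_iff)
    then show "frac_inv V K E \<subseteq> frac_inv V K (v_closure V K E)"
      using subset_v_closure unfolding v_closure_def by blast
  qed
  then show "v_closure V K (v_closure V K E) = v_closure V K E"
    by (simp add: v_closure_def)
next
  fix E F :: "'a set" assume "E \<subseteq> F"
  then show "v_closure V K E \<subseteq> v_closure V K F"
    unfolding v_closure_def by (intro frac_inv_antimono)
qed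

lemma star_operationD:
  assumes "star_operation V K s"
  shows "s \<in> fractional_ideals V K \<rightarrow> fractional_ideals V K"
    and "s V = V"
    and "\<forall>a \<in> carrier K - {\<zero>}. \<forall>E \<in> fractional_ideals V K. s (a <# E) = a <# s E"
    and "\<forall>E \<in> fractional_ideals V K. E \<subseteq> s E"
    and "\<forall>E \<in> fractional_ideals V K. \<forall>F \<in> fractional_ideals V K. E \<subseteq> F \<longrightarrow> s E \<subseteq> s F"
    and "\<forall>E \<in> fractional_ideals V K. s (s E) = s E"
  using assms unfolding star_operation_def by - (elim conjE, assumption)+

text \<open>
  Being a star operation depends only on the values at nonzero fractional ideals. That \<open>t\<close> preserves
  fractional ideals is needed here, because its values are arguments of \<open>s\<close> in the idempotence law.
\<close>

lemma star_operation_cong: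
  assumes eq: "\<And>I. I \<in> fractional_ideals V K \<Longrightarrow> s I = t I" and star: "star_operation V K t"
  shows "star_operation V K s"
proof -
  note t = star_operationD[OF star]
  have ran: "t E \<in> fractional_ideals V K" if "E \<in> fractional_ideals V K" for E
    using t(1) that by (rule funcset_mem)
  show ?thesis
    unfolding star_operation_def
  proof (intro conjI ballI impI)
    show "s \<in> fractional_ideals V K \<rightarrow> fractional_ideals V K"
      by (rule Pi_I) (simp only: eq ran)
    show "s V = V" unfolding eq[OF V_fractional] by (rule t(2))
    show "s (a <# E) = a <# s E"
      if a: "a \<in> carrier K - {\<zero>}" and E: "E \<in> fractional_ideals V K" for a E
    proof -
      have "a <# E \<in> fractional_ideals V K" using a E by (intro fractional_l_coset) auto
      then show ?thesis using bspec[OF bspec[OF t(3) a] E] eq E by metis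
    qed
    show "s E \<subseteq> s F"
      if E: "E \<in> fractional_ideals V K" and F: "F \<in> fractional_ideals V K" and "E \<subseteq> F" for E F
      unfolding eq[OF E] eq[OF F] using bspec[OF bspec[OF t(5) E] F] that(3) by (rule mp)
    show "E \<subseteq> s E" if E: "E \<in> fractional_ideals V K" for E
      unfolding eq[OF E] using t(4) E by (rule bspec)
    show "s (s E) = s E" if E: "E \<in> fractional_ideals V K" for E
      unfolding eq[OF E] eq[OF ran[OF E]] using t(6) E by (rule bspec)
  qed
qed


section \<open>Ideals of the domain as submodules\<close>

lemma domain_cring: "cring (K\<lparr>carrier := V\<rparr>)"
  using subring_is_domain[OF subring_axioms] by (rule domain.axioms(1))

lemma ideal_iff: "ideal I (K\<lparr>carrier := V\<rparr>) \<longleftrightarrow> submod I \<and> I \<subseteq> V"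
proof
  assume I: "ideal I (K\<lparr>carrier := V\<rparr>)"
  interpret I: ideal I "K\<lparr>carrier := V\<rparr>" by (rule I)
  have "I \<subseteq> V" using I.a_subset by simp
  moreover have "submod I"
  proof (rule submodI)
    show "I \<subseteq> carrier K" using \<open>I \<subseteq> V\<close> V_carrier by blast
    show "\<zero> \<in> I" using additive_subgroup.zero_closed[OF I.is_additive_subgroup] by simp
    show "x \<oplus> y \<in> I" if "x \<in> I" "y \<in> I" for x y using additive_subgroup.a_closed[OF I.is_additive_subgroup that] by simp
    show "r \<otimes> x \<in> I" if "r \<in> V" "x \<in> I" for r x using I.I_l_closed[of x r] that by simp
  qed
  ultimately show "submod I \<and> I \<subseteq> V" by simp
next
  assume "submod I \<and> I \<subseteq> V"
  then have I: "submod I" "I \<subseteq> V" by auto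
  show "ideal I (K\<lparr>carrier := V\<rparr>)"
  proof (rule idealI)
    show "ring (K\<lparr>carrier := V\<rparr>)" using domain_cring by (rule cring.axioms(1))
    have "subgroup I (add_monoid K)" "subgroup V (add_monoid K)"
      using I(1) submod_V by (auto simp: submod_def additive_subgroup_def)
    then show "subgroup I (add_monoid (K\<lparr>carrier := V\<rparr>))"
      using group.subgroup_incl[OF a_group _ _ I(2)] by simp
    show l: "r \<otimes>\<^bsub>K\<lparr>carrier := V\<rparr>\<^esub> x \<in> I" if "x \<in> I" "r \<in> carrier (K\<lparr>carrier := V\<rparr>)" for x r
      using submodD(4)[OF I(1)] that by simp
    show "x \<otimes>\<^bsub>K\<lparr>carrier := V\<rparr>\<^esub> r \<in> I" if "x \<in> I" "r \<in> carrier (K\<lparr>carrier := V\<rparr>)" for x r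
      using l[OF that] that submodD(1)[OF I(1)] V_carrier by (simp add: m_comm)
  qed
qed

lemma ideal_prod_subring: "ideal_prod (K\<lparr>carrier := V\<rparr>) I J = ideal_prod K I J"
proof (intro equalityI subsetI)
  show "x \<in> ideal_prod K I J" if "x \<in> ideal_prod (K\<lparr>carrier := V\<rparr>) I J" for x
    using that by induction (auto intro: ideal_prod.intros)
  show "x \<in> ideal_prod (K\<lparr>carrier := V\<rparr>) I J" if "x \<in> ideal_prod K I J" for x
    using that
  proof induction
    case (prod i j)
    then show ?case using ideal_prod.prod[of i I j J "K\<lparr>carrier := V\<rparr>"] by simp
  next
    case (sum s1 s2)
    then show ?case using ideal_prod.sum[of s1 "K\<lparr>carrier := V\<rparr>" I J s2] by simp
  qed
qed

end


section \<open>Products and powers in a valuation domain\<close>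

context valuation_domain
begin

text \<open>Divisibility by elements of \<open>V\<close> is a total preorder on the quotient field.\<close>

lemma dvd_total:
  assumes "a \<in> carrier K" "b \<in> carrier K"
  obtains (le) v where "v \<in> V" "a = v \<otimes> b" | (ge) v where "v \<in> V" "b = v \<otimes> a"
proof (cases "a = \<zero> \<or> b = \<zero>")
  case True
  then show thesis using le[OF V_zero] ge[OF V_zero] assms by auto
next
  case False
  then have ne: "a \<noteq> \<zero>" "b \<noteq> \<zero>" by auto
  define q where "q = a \<otimes> inv b"
  have ib: "inv b \<in> carrier K" "inv b \<otimes> b = \<one>" "inv b \<noteq> \<zero>" using inv_nonzero assms ne by auto
  have q: "q \<in> carrier K" "q \<noteq> \<zero>" unfolding q_def using assms ne ib by (auto simp: integral_iff)
  have a: "a = q \<otimes> b" unfolding q_def using assms ib by (simp add: m_assoc)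
  have b: "b = inv q \<otimes> a" unfolding a using inv_mult_cancel(1)[OF q assms(2)] by simp
  show thesis using valuation[of q] q le[OF _ a] ge[OF _ b] by auto
qed

text \<open>
  Of two products, one divides the other, so their sum is again a single product: in a valuation
  domain the product of two submodules consists of the products of their elements.
\<close>

lemma mem_ideal_prod_iff:
  assumes I: "submod I" and J: "submod J"
  shows "x \<in> ideal_prod K I J \<longleftrightarrow> (\<exists>i \<in> I. \<exists>j \<in> J. x = i \<otimes> j)"
proof
  assume "x \<in> ideal_prod K I J"
  then show "\<exists>i \<in> I. \<exists>j \<in> J. x = i \<otimes> j"
  proof induction
    case (sum s1 s2)
    then obtain i1 j1 i2 j2
      where ij: "i1 \<in> I" "j1 \<in> J" "s1 = i1 \<otimes> j1" "i2 \<in> I" "j2 \<in> J" "s2 = i2 \<otimes> j2" by blast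
    then have c: "i1 \<in> carrier K" "j1 \<in> carrier K" "i2 \<in> carrier K" "j2 \<in> carrier K"
      using submodD(1) I J by auto
    then have s: "s1 \<in> carrier K" "s2 \<in> carrier K" using ij by auto
    have V1: "v \<oplus> \<one> \<in> V" if "v \<in> V" for v using that V_add V_one by auto
    from s show ?case
    proof (cases rule: dvd_total)
      case (le v)
      then have "s1 \<oplus> s2 = ((v \<oplus> \<one>) \<otimes> i2) \<otimes> j2"
        using c s ij(6) V_carrier by (simp add: l_distr m_assoc)
      then show ?thesis using submodD(4)[OF I V1[OF le(1)] ij(4)] ij(5) by blast
    next
      case (ge v)
      then have "s1 \<oplus> s2 = ((v \<oplus> \<one>) \<otimes> i1) \<otimes> j1"
        using c s ij(3) V_carrier by (simp add: l_distr m_assoc a_comm)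
      then show ?thesis using submodD(4)[OF I V1[OF ge(1)] ij(1)] ij(2) by blast
    qed
  qed blast
qed (auto intro: ideal_prod.prod)

lemma idempotent_factor:
  assumes "submod P" "ideal_prod K P P = P" "z \<in> P"
  obtains p q where "p \<in> P" "q \<in> P" "z = p \<otimes> q"
proof -
  have "z \<in> ideal_prod K P P" using assms(2,3) by simp
  then show thesis unfolding mem_ideal_prod_iff[OF assms(1,1)] using that by blast
qed

lemma submod_ideal_prod:
  assumes I: "submod I" and J: "submod J"
  shows "submod (ideal_prod K I J)"
proof (rule submodI)
  show "ideal_prod K I J \<subseteq> carrier K"
    using submodD(1) I J by (auto simp: mem_ideal_prod_iff[OF I J])
  show "\<zero> \<in> ideal_prod K I J"
    using ideal_prod.prod[OF submodD(2)[OF I] submodD(2)[OF J], of K] by simp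
  show "x \<oplus> y \<in> ideal_prod K I J" if "x \<in> ideal_prod K I J" "y \<in> ideal_prod K I J" for x y
    using that by (rule ideal_prod.sum)
  show "r \<otimes> x \<in> ideal_prod K I J" if r: "r \<in> V" and "x \<in> ideal_prod K I J" for r x
  proof -
    obtain i j where ij: "i \<in> I" "j \<in> J" "x = i \<otimes> j"
      using \<open>x \<in> _\<close> by (auto simp: mem_ideal_prod_iff[OF I J])
    then have "r \<otimes> x = (r \<otimes> i) \<otimes> j"
      using submodD(1) I J V_carrier[OF r] by (simp add: m_assoc)
    then show ?thesis using ideal_prod.prod[OF submodD(4)[OF I r ij(1)] ij(2), of K] by simp
  qed
qed

lemma ideal_prod_assoc:
  assumes I: "submod I" and J: "submod J" and L: "submod L"
  shows "ideal_prod K (ideal_prod K I J) L = ideal_prod K I (ideal_prod K J L)"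
proof -
  have assoc: "i \<otimes> j \<otimes> l = i \<otimes> (j \<otimes> l)" if "i \<in> I" "j \<in> J" "l \<in> L" for i j l
    using that submodD(1) I J L by (simp add: m_assoc)
  note prods = mem_ideal_prod_iff[OF submod_ideal_prod[OF I J] L]
    mem_ideal_prod_iff[OF I submod_ideal_prod[OF J L]]
    mem_ideal_prod_iff[OF I J] mem_ideal_prod_iff[OF J L]
  show ?thesis
  proof (intro equalityI subsetI)
    fix x assume "x \<in> ideal_prod K (ideal_prod K I J) L"
    then obtain i j l where "i \<in> I" "j \<in> J" "l \<in> L" "x = i \<otimes> j \<otimes> l" by (auto simp: prods)
    then show "x \<in> ideal_prod K I (ideal_prod K J L)" using assoc ideal_prod.prod by metis
  next
    fix x assume "x \<in> ideal_prod K I (ideal_prod K J L)"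
    then obtain i j l where "i \<in> I" "j \<in> J" "l \<in> L" "x = i \<otimes> (j \<otimes> l)" by (auto simp: prods)
    then show "x \<in> ideal_prod K (ideal_prod K I J) L" using assoc ideal_prod.prod by metis
  qed
qed

lemma ideal_prod_V:
  assumes "submod I"
  shows "ideal_prod K V I = I" "ideal_prod K I V = I"
proof -
  have "x \<in> ideal_prod K V I" "x \<in> ideal_prod K I V" if "x \<in> I" for x
    using ideal_prod.prod[OF V_one that, of K] ideal_prod.prod[OF that V_one, of K]
      submodD(1)[OF assms that] by auto
  moreover have "v \<otimes> x \<in> I" "x \<otimes> v \<in> I" if "x \<in> I" "v \<in> V" for x v
    using submodD(4)[OF assms that(2,1)] submodD(1)[OF assms that(1)] V_carrier[OF that(2)]
    by (auto simp: m_comm)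
  ultimately show "ideal_prod K V I = I" "ideal_prod K I V = I"
    by (auto simp: mem_ideal_prod_iff[OF submod_V assms] mem_ideal_prod_iff[OF assms submod_V])
qed

lemma submod_ideal_pow: "submod I \<Longrightarrow> submod (ideal_pow V K I n)"
  by (induction n) (auto intro: submod_V submod_ideal_prod)

lemma ideal_pow_add:
  assumes "submod I"
  shows "ideal_pow V K I (m + n) = ideal_prod K (ideal_pow V K I m) (ideal_pow V K I n)"
  by (induction m) (auto simp: ideal_prod_V ideal_prod_assoc submod_ideal_pow assms)

lemma ideal_pow_l_coset:
  assumes a: "a \<in> carrier K" and I: "submod I"
  shows "ideal_pow V K (a <# I) n = a [^] n <# ideal_pow V K I n"
proof (induction n)
  case 0
  have "\<one> \<otimes> v = v" if "v \<in> V" for v using V_carrier[OF that] by simp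
  then show ?case by (auto simp: l_coset_def)
next
  case (Suc n)
  let ?J = "ideal_pow V K I n"
  have J: "submod ?J" using submod_ideal_pow[OF I] .
  have an: "a [^] n \<in> carrier K" using a by simp
  have eq: "(a \<otimes> i) \<otimes> (a [^] n \<otimes> j) = a [^] Suc n \<otimes> (i \<otimes> j)" if "i \<in> I" "j \<in> ?J" for i j
    using a an submodD(1)[OF I that(1)] submodD(1)[OF J that(2)] by (simp add: m_ac)
  have "x \<in> ideal_prod K (a <# I) (a [^] n <# ?J) \<longleftrightarrow> (\<exists>i\<in>I. \<exists>j\<in>?J. x = (a \<otimes> i) \<otimes> (a [^] n \<otimes> j))" for x
    unfolding mem_ideal_prod_iff[OF submod_l_coset[OF a I] submod_l_coset[OF an J]]
    by (auto simp: l_coset_def)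
  moreover have "x \<in> a [^] Suc n <# ideal_prod K I ?J \<longleftrightarrow>
      (\<exists>i\<in>I. \<exists>j\<in>?J. x = a [^] Suc n \<otimes> (i \<otimes> j))" for x
    unfolding l_coset_def UN_iff singleton_iff Bex_def mem_ideal_prod_iff[OF I J] by blast
  ultimately show ?case by (simp add: Suc set_eq_iff eq del: nat_pow_Suc)
qed

lemma ideal_pow_subset:
  assumes "submod J" "J \<subseteq> V" "n \<ge> 1"
  shows "ideal_pow V K J n \<subseteq> J"
proof -
  have subV: "ideal_pow V K J k \<subseteq> V" for k
    by (induction k)
      (use assms V_mult in \<open>auto simp: mem_ideal_prod_iff submod_ideal_pow subset_iff\<close>)
  obtain k where "n = Suc k" using assms(3) by (cases n) auto
  have JV: "j \<otimes> p \<in> J" if "j \<in> J" "p \<in> V" for j p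
    using submodD(4)[OF assms(1) that(2,1)] submodD(1)[OF assms(1) that(1)] V_carrier[OF that(2)]
    by (simp add: m_comm)
  show ?thesis
  proof
    fix x assume "x \<in> ideal_pow V K J n"
    then obtain i j where "i \<in> J" "j \<in> ideal_pow V K J k" "x = i \<otimes> j"
      using assms(1) \<open>n = Suc k\<close> by (auto simp: mem_ideal_prod_iff submod_ideal_pow)
    then show "x \<in> J" using JV subV[of k] by blast
  qed
qed

lemma ideal_pow_nonzero:
  assumes J: "submod J" and "J \<noteq> {\<zero>}"
  shows "ideal_pow V K J n \<noteq> {\<zero>}"
proof -
  obtain x where x: "x \<in> J" "x \<noteq> \<zero>" "x \<in> carrier K" using submod_nonzero_element[OF assms] .
  have "x [^] n \<in> ideal_pow V K J n"
  proof (induction n)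
    case (Suc n)
    have "x \<otimes> x [^] n \<in> ideal_pow V K J (Suc n)"
      using ideal_prod.prod[OF x(1) Suc, of K] by simp
    then show ?case using x(3) by (simp add: m_comm)
  qed (simp add: V_one)
  moreover have "x [^] n \<noteq> \<zero>" using x by (induction n) (auto simp: integral_iff)
  ultimately show ?thesis by auto
qed


section \<open>The maximal ideal and idempotent ideals\<close>

text \<open>The nonunits of \<open>V\<close>, which form its maximal ideal \<open>M\<close>.\<close>

definition nonunits :: "'a set" where
  "nonunits = {x \<in> V. \<forall>y \<in> V. x \<otimes> y \<noteq> \<one>}"

lemma inv_notin_of_nonunit:
  assumes "m \<in> nonunits" "m \<noteq> \<zero>"
  shows "inv m \<notin> V"
  using assms inv_nonzero(2)[of m] V_carrier by (auto simp: nonunits_def)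

lemma submod_nonunits: "submod nonunits"
proof (rule submodI)
  show "nonunits \<subseteq> carrier K" "\<zero> \<in> nonunits"
    using V_carrier V_zero by (auto simp: nonunits_def)
  show sc: "r \<otimes> x \<in> nonunits" if r: "r \<in> V" and x: "x \<in> nonunits" for r x
  proof -
    have xV: "x \<in> V" using x by (simp add: nonunits_def)
    have "r \<otimes> x \<otimes> y \<noteq> \<one>" if y: "y \<in> V" for y
    proof -
      have "r \<otimes> x \<otimes> y = x \<otimes> (r \<otimes> y)" using r xV y V_carrier by (simp add: m_ac)
      then show ?thesis using x V_mult[OF r y] by (simp add: nonunits_def)
    qed
    then show ?thesis using V_mult[OF r xV] by (simp add: nonunits_def)
  qed
  show "x \<oplus> y \<in> nonunits" if xy: "x \<in> nonunits" "y \<in> nonunits" for x y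
  proof -
    have c: "x \<in> carrier K" "y \<in> carrier K" using xy V_carrier by (auto simp: nonunits_def)
    have V1: "v \<oplus> \<one> \<in> V" if "v \<in> V" for v using that V_add V_one by auto
    from c show ?thesis
    proof (cases rule: dvd_total)
      case (le v)
      then have "x \<oplus> y = (v \<oplus> \<one>) \<otimes> y" using c V_carrier by (simp add: l_distr)
      then show ?thesis using sc[OF V1[OF le(1)] xy(2)] by simp
    next
      case (ge v)
      then have "x \<oplus> y = (v \<oplus> \<one>) \<otimes> x" using c V_carrier by (simp add: l_distr a_comm)
      then show ?thesis using sc[OF V1[OF ge(1)] xy(1)] by simp
    qed
  qed
qed

lemma nonunits_subset: "nonunits \<subseteq> V" by (auto simp: nonunits_def)

lemma one_notin_nonunits: "\<one> \<notin> nonunits"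
  using V_one by (auto simp: nonunits_def)

lemma proper_subset_nonunits:
  assumes J: "submod J" "J \<subseteq> V" "\<one> \<notin> J"
  shows "J \<subseteq> nonunits"
proof
  fix x assume x: "x \<in> J"
  have "x \<otimes> y \<noteq> \<one>" if "y \<in> V" for y
    using submodD(4)[OF J(1) that x] submodD(1)[OF J(1) x] V_carrier[OF that] J(3)
    by (auto simp: m_comm)
  then show "x \<in> nonunits" using x J(2) by (auto simp: nonunits_def)
qed

lemma submod_eq_V:
  assumes "submod J" "J \<subseteq> V" "\<one> \<in> J"
  shows "J = V"
proof -
  have "r \<in> J" if "r \<in> V" for r
    using submodD(4)[OF assms(1) that assms(3)] V_carrier[OF that] by simp
  then show ?thesis using assms(2) by auto
qed

lemma maximalideal_iff: "maximalideal P (K\<lparr>carrier := V\<rparr>) \<longleftrightarrow> P = nonunits"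
proof
  assume P: "maximalideal P (K\<lparr>carrier := V\<rparr>)"
  then have "submod P" "P \<subseteq> V" "P \<noteq> V"
    using maximalideal.axioms(1)[OF P] maximalideal.I_notcarr[OF P] by (auto simp: ideal_iff)
  then have "P \<subseteq> nonunits" using proper_subset_nonunits submod_eq_V by blast
  then show "P = nonunits"
    using maximalideal.I_maximal[OF P, of nonunits] submod_nonunits nonunits_subset
      one_notin_nonunits V_one by (auto simp: ideal_iff)
next
  assume P: "P = nonunits"
  show "maximalideal P (K\<lparr>carrier := V\<rparr>)"
    unfolding P
  proof (rule maximalidealI)
    show "ideal nonunits (K\<lparr>carrier := V\<rparr>)"
      using submod_nonunits nonunits_subset by (simp add: ideal_iff)
    show "carrier (K\<lparr>carrier := V\<rparr>) \<noteq> nonunits"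
    proof
      assume "carrier (K\<lparr>carrier := V\<rparr>) = nonunits"
      then have "carrier (K\<lparr>carrier := V\<rparr>) \<subseteq> nonunits" by (rule equalityD1)
      then have "V \<subseteq> nonunits" by simp
      then show False using V_one one_notin_nonunits by blast
    qed
    show "J = nonunits \<or> J = carrier (K\<lparr>carrier := V\<rparr>)"
      if J: "ideal J (K\<lparr>carrier := V\<rparr>)" "nonunits \<subseteq> J" for J
    proof (cases "\<one> \<in> J")
      case True
      then show ?thesis using submod_eq_V[of J] J(1) by (simp add: ideal_iff)
    next
      case False
      then show ?thesis using proper_subset_nonunits[of J] J by (simp add: ideal_iff subset_antisym)
    qed
  qed
qed

text \<open>An element outside a submodule properly divides every element of the submodule.\<close>

lemma notin_submod_factor:
  assumes I: "submod I" and x: "x \<in> carrier K" "x \<notin> I" and i: "i \<in> I"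
  obtains m where "m \<in> nonunits" "i = m \<otimes> x"
proof -
  have ic: "i \<in> carrier K" using submodD(1)[OF I i] .
  from ic x(1) show thesis
  proof (cases rule: dvd_total)
    case (le v)
    have "v \<otimes> w \<noteq> \<one>" if w: "w \<in> V" for w
    proof
      assume vw: "v \<otimes> w = \<one>"
      have "w \<otimes> i = (v \<otimes> w) \<otimes> x" using le x(1) V_carrier[OF w] V_carrier[of v] by (simp add: m_ac)
      then have "x = w \<otimes> i" using vw x(1) by simp
      then show False using submodD(4)[OF I w i] x(2) by simp
    qed
    then show thesis using that le by (auto simp: nonunits_def)
  next
    case (ge v)
    then show thesis using submodD(4)[OF I ge(1) i] x(2) by simp
  qed
qed

lemma subset_l_coset_nonunits:
  assumes I: "submod I" and x: "x \<in> carrier K" "x \<notin> I"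
  shows "I \<subseteq> x <# nonunits"
proof
  fix i assume "i \<in> I"
  then obtain m where m: "m \<in> nonunits" "i = m \<otimes> x" using notin_submod_factor[OF I x] by metis
  then have "i = x \<otimes> m" using submodD(1)[OF submod_nonunits m(1)] x(1) by (simp add: m_comm)
  then show "i \<in> x <# nonunits" using m(1) by (auto simp: l_coset_def)
qed

text \<open>
  If \<open>ab\<close> lies in \<open>P\<close> with neither factor in \<open>P\<close>, then \<open>P\<close> is contained in \<open>aM\<close> and in \<open>bM\<close>, so that
  \<open>ab\<close>, being an element of \<open>P\<^sup>2\<close>, would be a multiple of itself by a nonunit.
\<close>

lemma idempotent_imp_primeideal:
  assumes P: "submod P" "P \<subseteq> V" "\<one> \<notin> P" "P \<noteq> {\<zero>}" and idem: "ideal_prod K P P = P"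
  shows "primeideal P (K\<lparr>carrier := V\<rparr>)"
proof (rule primeidealI)
  show "ideal P (K\<lparr>carrier := V\<rparr>)" using P by (simp add: ideal_iff)
  show "cring (K\<lparr>carrier := V\<rparr>)" by (rule domain_cring)
  show "carrier (K\<lparr>carrier := V\<rparr>) \<noteq> P" using P V_one by auto
  fix a b
  assume "a \<in> carrier (K\<lparr>carrier := V\<rparr>)" "b \<in> carrier (K\<lparr>carrier := V\<rparr>)"
    and "a \<otimes>\<^bsub>K\<lparr>carrier := V\<rparr>\<^esub> b \<in> P"
  then have ab: "a \<in> V" "b \<in> V" "a \<otimes> b \<in> P" by auto
  show "a \<in> P \<or> b \<in> P"
  proof (rule ccontr)
    assume "\<not> (a \<in> P \<or> b \<in> P)"
    then have nab: "a \<notin> P" "b \<notin> P" by auto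
    have c: "a \<in> carrier K" "b \<in> carrier K" using ab V_carrier by auto
    obtain p q where pq: "p \<in> P" "q \<in> P" "a \<otimes> b = p \<otimes> q"
      using idempotent_factor[OF P(1) idem ab(3)] .
    obtain m where m: "m \<in> nonunits" "p = m \<otimes> a" using notin_submod_factor[OF P(1) c(1) nab(1) pq(1)] .
    obtain n where n: "n \<in> nonunits" "q = n \<otimes> b" using notin_submod_factor[OF P(1) c(2) nab(2) pq(2)] .
    have mn: "m \<in> V" "n \<in> V" "m \<in> carrier K" "n \<in> carrier K"
      using m n nonunits_subset V_carrier by auto
    have "a \<otimes> b \<otimes> (m \<otimes> n) = p \<otimes> q" using m(2) n(2) c mn by (simp add: m_ac)
    then have "a \<otimes> b \<otimes> (m \<otimes> n) = a \<otimes> b \<otimes> \<one>" using c by (simp add: pq(3)[symmetric])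
    moreover have "a \<noteq> \<zero>" "b \<noteq> \<zero>" using nab submodD(2)[OF P(1)] by auto
    then have "a \<otimes> b \<noteq> \<zero>" using c integral by blast
    ultimately have "m \<otimes> n = \<one>"
      using m_lcancel[of "a \<otimes> b" "m \<otimes> n" \<one>] c mn(3,4) by simp
    then show False using m(1) mn(2) by (auto simp: nonunits_def)
  qed
qed


section \<open>Elements added by the two closures\<close>

text \<open>
  Consequently a nonzero fractional ideal of a valuation domain is divisorial unless \<open>M\<close> is idempotent
  and the ideal has the form \<open>xM\<close>.
\<close>

lemma v_closure_new_element:
  assumes I: "I \<in> fractional_ideals V K" and x: "x \<in> v_closure V K I" "x \<notin> I"
  shows "I = x <# nonunits" "ideal_prod K nonunits nonunits = nonunits"
proof -
  have s: "submod I" using I fractional_ideals_iff by auto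
  have xc: "x \<in> carrier K" and x0: "x \<noteq> \<zero>"
    using x submodD(2)[OF s] by (auto simp: v_closure_def frac_inv_iff)
  \<comment> \<open>If \<open>I\<close> lay in \<open>xmV\<close>, so would its v-closure; but \<open>x\<close> is not in \<open>xmV\<close>, as \<open>m\<close> is a nonunit.\<close>
  have key: False
    if m: "m \<in> nonunits" "m \<noteq> \<zero>"
      and le: "\<And>i. i \<in> I \<Longrightarrow> \<exists>v \<in> V. i = v \<otimes> (x \<otimes> m)" for m
  proof -
    have mc: "m \<in> carrier K" using submodD(1)[OF submod_nonunits m(1)] .
    define y where "y = inv (x \<otimes> m)"
    have xm: "x \<otimes> m \<in> carrier K" "x \<otimes> m \<noteq> \<zero>" using xc mc x0 m(2) by (auto simp: integral_iff)
    note y = inv_nonzero[OF xm, folded y_def]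
    have "y \<otimes> i \<in> V" if i: "i \<in> I" for i
    proof -
      obtain v where v: "v \<in> V" "i = v \<otimes> (x \<otimes> m)" using le[OF i] by auto
      then have "y \<otimes> i = v \<otimes> (y \<otimes> (x \<otimes> m))" using y(1) xm(1) V_carrier by (simp add: m_lcomm)
      then show ?thesis using v(1) V_carrier y(3) by simp
    qed
    then have "y \<in> frac_inv V K I" using y(1) by (simp add: frac_inv_iff)
    then have "x \<otimes> y \<in> V" using x(1) by (simp add: v_closure_def frac_inv_iff)
    moreover have "m \<otimes> (x \<otimes> y) = \<one>" using y(2) mc xc y(1) by (simp add: m_ac)
    ultimately show False using m(1) by (auto simp: nonunits_def)
  qed
  show I_eq: "I = x <# nonunits"
  proof (rule equalityI[OF subset_l_coset_nonunits[OF s xc x(2)]], rule subsetI, rule ccontr)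
    \<comment> \<open>An element \<open>z = xm\<close> outside \<open>I\<close> would divide all of \<open>I\<close>.\<close>
    fix z assume "z \<in> x <# nonunits" and z: "z \<notin> I"
    then obtain m where m: "m \<in> nonunits" "z = x \<otimes> m" by (auto simp: l_coset_def)
    have mc: "m \<in> carrier K" using submodD(1)[OF submod_nonunits m(1)] .
    have "m \<noteq> \<zero>" using z m(2) xc submodD(2)[OF s] by auto
    moreover have "\<exists>v \<in> V. i = v \<otimes> (x \<otimes> m)" if i: "i \<in> I" for i
    proof -
      have "z \<in> carrier K" using m(2) xc mc by simp
      then obtain v where "v \<in> nonunits" "i = v \<otimes> z" using notin_submod_factor[OF s _ z i] by metis
      then show ?thesis using m(2) nonunits_subset by blast
    qed
    ultimately show False using key[OF m(1)] by blast
  qed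
  let ?MM = "ideal_prod K nonunits nonunits"
  have MMs: "submod ?MM" using submod_ideal_prod submod_nonunits by auto
  show "?MM = nonunits"
  proof (intro equalityI subsetI)
    show "z \<in> nonunits" if "z \<in> ?MM" for z
      using that submodD(4)[OF submod_nonunits] nonunits_subset
      by (auto simp: mem_ideal_prod_iff submod_nonunits)
    fix m assume m: "m \<in> nonunits"
    show "m \<in> ?MM"
    proof (rule ccontr)
      assume nm: "m \<notin> ?MM"
      have mc: "m \<in> carrier K" using submodD(1)[OF submod_nonunits m] .
      \<comment> \<open>Since \<open>m\<close> is not in \<open>M\<^sup>2\<close>, it generates \<open>M\<close>, and so \<open>I = xM\<close> lies in \<open>xmV\<close>.\<close>
      have gen: "\<exists>v \<in> V. n = v \<otimes> m" if n: "n \<in> nonunits" for n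
      proof (rule ccontr)
        assume "\<not> (\<exists>v \<in> V. n = v \<otimes> m)"
        then have "n \<notin> m <# V" using V_carrier mc by (auto simp: l_coset_def m_comm)
        moreover have "m \<in> m <# V" unfolding l_coset_def by (rule UN_I[OF V_one]) (simp add: mc)
        ultimately obtain k where "k \<in> nonunits" "m = k \<otimes> n"
          using notin_submod_factor[OF submod_l_coset[OF mc submod_V] submodD(1)[OF submod_nonunits n]]
          by metis
        then show False using nm n ideal_prod.prod by metis
      qed
      have "\<exists>v \<in> V. i = v \<otimes> (x \<otimes> m)" if i: "i \<in> I" for i
      proof -
        obtain n where n: "n \<in> nonunits" "i = x \<otimes> n" using i I_eq by (auto simp: l_coset_def)
        obtain v where "v \<in> V" "n = v \<otimes> m" using gen[OF n(1)] by auto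
        then show ?thesis using n(2) xc mc V_carrier by (auto simp: m_lcomm)
      qed
      moreover have "m \<noteq> \<zero>" using nm submodD(2)[OF MMs] by auto
      ultimately show False using key[OF m] by blast
    qed
  qed
qed

text \<open>
  If \<open>y\<close> maps \<open>xM\<close> into \<open>V\<close> but \<open>xy\<close> is not in \<open>V\<close>, then \<open>z = (xy)\<^sup>-\<^sup>1\<close> is a nonunit. Writing \<open>z = pq\<close>
  with \<open>p\<close> and \<open>q\<close> in \<open>M\<close> makes \<open>xyp\<close>, an element of \<open>V\<close>, an inverse of the nonunit \<open>q\<close>.
\<close>

lemma mem_v_closure_of_idempotent:
  assumes x: "x \<in> carrier K" and idem: "ideal_prod K nonunits nonunits = nonunits"
  shows "x \<in> v_closure V K (x <# nonunits)"
proof -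
  have "x \<otimes> y \<in> V" if y: "y \<in> frac_inv V K (x <# nonunits)" for y
  proof (rule ccontr)
    assume n: "x \<otimes> y \<notin> V"
    have yc: "y \<in> carrier K" and ym: "\<And>m. m \<in> nonunits \<Longrightarrow> y \<otimes> (x \<otimes> m) \<in> V"
      using y by (auto simp: frac_inv_iff l_coset_def)
    have xy: "x \<otimes> y \<in> carrier K" "x \<otimes> y \<noteq> \<zero>" using n x yc V_zero by auto
    define z where "z = inv (x \<otimes> y)"
    note z = inv_nonzero[OF xy, folded z_def]
    have zV: "z \<in> V" using valuation[of "x \<otimes> y"] xy n z_def by auto
    have "z \<otimes> w \<noteq> \<one>" if w: "w \<in> V" for w
    proof
      assume zw: "z \<otimes> w = \<one>"
      have "w = (z \<otimes> (x \<otimes> y)) \<otimes> w" using z(3) V_carrier[OF w] by simp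
      also have "\<dots> = (z \<otimes> w) \<otimes> (x \<otimes> y)" using z(1) xy(1) V_carrier[OF w] by (simp only: m_ac m_closed)
      finally have "w = x \<otimes> y" using zw xy(1) by simp
      then show False using n w by simp
    qed
    then have zM: "z \<in> nonunits" using zV by (simp add: nonunits_def)
    obtain p q where pq: "p \<in> nonunits" "q \<in> nonunits" "z = p \<otimes> q"
      using idempotent_factor[OF submod_nonunits idem zM] .
    then have c: "p \<in> carrier K" "q \<in> carrier K" using submodD(1)[OF submod_nonunits] by auto
    have "q \<otimes> (y \<otimes> (x \<otimes> p)) = \<one>" using z(2) pq(3) c x yc by (simp add: m_ac)
    then show False using ym[OF pq(1)] pq(2) by (auto simp: nonunits_def)
  qed
  then show ?thesis using x by (simp add: v_closure_def frac_inv_iff[of x])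
qed

lemma ratliff_rush_iff:
  "x \<in> ratliff_rush V K I \<longleftrightarrow> x \<in> carrier K \<and>
     (\<exists>n \<ge> 1. \<forall>p \<in> ideal_pow V K I n. x \<otimes> p \<in> ideal_pow V K I (Suc n))"
  by (auto simp: ratliff_rush_def l_coset_def subset_iff)

lemma subset_ratliff_rush:
  assumes "submod I"
  shows "I \<subseteq> ratliff_rush V K I"
  using submodD(1)[OF assms]
  by (auto simp: ratliff_rush_iff intro!: exI[of _ 1] ideal_prod.prod)

lemma mem_ratliff_rush_of_idempotent:
  assumes x: "x \<in> carrier K" and idem: "ideal_prod K nonunits nonunits = nonunits"
  shows "x \<in> ratliff_rush V K (x <# nonunits)"
proof -
  let ?I = "x <# nonunits"
  have s: "submod ?I" using submod_l_coset[OF x submod_nonunits] .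
  have "x \<otimes> i \<in> ideal_prod K ?I ?I" if i: "i \<in> ?I" for i
  proof -
    obtain m where m: "m \<in> nonunits" "i = x \<otimes> m" using i by (auto simp: l_coset_def)
    obtain p q where pq: "p \<in> nonunits" "q \<in> nonunits" "m = p \<otimes> q"
      using idempotent_factor[OF submod_nonunits idem m(1)] .
    then have "p \<in> carrier K" "q \<in> carrier K" using submodD(1)[OF submod_nonunits] by auto
    then have "x \<otimes> i = (x \<otimes> p) \<otimes> (x \<otimes> q)" using m(2) pq(3) x by (simp add: m_ac)
    moreover have "x \<otimes> p \<in> ?I" "x \<otimes> q \<in> ?I" using pq by (auto simp: l_coset_def)
    ultimately show ?thesis using ideal_prod.prod by metis
  qed
  then show ?thesis using x
    by (auto simp: ratliff_rush_iff ideal_prod_V[OF s] intro!: exI[of _ 1])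
qed

lemma ratliff_rush_new_element:
  assumes nonidem: "\<forall>P. primeideal P (K\<lparr>carrier := V\<rparr>) \<and> P \<noteq> {\<zero>} \<and> P \<noteq> nonunits \<longrightarrow>
      ideal_prod K P P \<noteq> P"
    and I: "I \<in> fractional_ideals V K" and x: "x \<in> ratliff_rush V K I" "x \<notin> I"
  shows "I = x <# nonunits" "ideal_prod K nonunits nonunits = nonunits"
proof -
  have s: "submod I" and ne: "I \<noteq> {\<zero>}" using I fractional_ideals_iff by auto
  have xc: "x \<in> carrier K" and x0: "x \<noteq> \<zero>"
    using x submodD(2)[OF s] by (auto simp: ratliff_rush_iff)
  obtain n where n: "n \<ge> 1"
    "\<And>p. p \<in> ideal_pow V K I n \<Longrightarrow> x \<otimes> p \<in> ideal_pow V K I (Suc n)"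
    using x(1) unfolding ratliff_rush_iff by blast
  define J where "J = inv x <# I"
  have I_eq: "I = x <# J"
    unfolding J_def using l_coset_inv_cancel(1)[OF xc x0] submodD(1)[OF s] by (simp add: subset_iff)
  have Js: "submod J" unfolding J_def using submod_l_coset[OF inv_nonzero(1)[OF xc x0] s] .
  have "J \<subseteq> inv x <# (x <# nonunits)"
    unfolding J_def using subset_l_coset_nonunits[OF s xc x(2)] by (auto simp: l_coset_def)
  then have JM: "J \<subseteq> nonunits"
    using l_coset_inv_cancel(2)[OF xc x0, of nonunits] submodD(1)[OF submod_nonunits] by auto
  have JV: "J \<subseteq> V" using JM nonunits_subset by auto
  have Jne: "J \<noteq> {\<zero>}" using ne I_eq xc by (auto simp: l_coset_def)
  let ?P = "ideal_pow V K J"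
  have Ps: "submod (?P k)" for k using submod_ideal_pow[OF Js] .
  have pow: "x [^] n \<in> carrier K" "x [^] n \<noteq> \<zero>" for n :: nat
    using xc x0 by (auto, induction n) (auto simp: integral_iff)
  \<comment> \<open>Cancelling \<open>x\<^sup>n\<^sup>+\<^sup>1\<close> turns \<open>xI\<^sup>n \<subseteq> I\<^sup>n\<^sup>+\<^sup>1\<close> into \<open>J\<^sup>n \<subseteq> J\<^sup>n\<^sup>+\<^sup>1\<close>.\<close>
  have "?P n \<subseteq> ?P (Suc n)"
  proof
    fix p assume p: "p \<in> ?P n"
    have pc: "p \<in> carrier K" using submodD(1)[OF Ps p] .
    have "x [^] n \<otimes> p \<in> ideal_pow V K I n"
      unfolding I_eq ideal_pow_l_coset[OF xc Js] using p by (auto simp: l_coset_def)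
    from n(2)[OF this] have "x \<otimes> (x [^] n \<otimes> p) \<in> x [^] Suc n <# ?P (Suc n)"
      unfolding I_eq ideal_pow_l_coset[OF xc Js] .
    then obtain q where q: "q \<in> ?P (Suc n)" "x \<otimes> (x [^] n \<otimes> p) = x [^] Suc n \<otimes> q"
      by (auto simp: l_coset_def simp del: nat_pow_Suc ideal_pow.simps)
    have qc: "q \<in> carrier K" using submodD(1)[OF Ps q(1)] .
    have "x \<otimes> (x [^] n \<otimes> p) = x [^] Suc n \<otimes> p" using xc pc pow(1)[of n] by (simp add: m_ac)
    then have "p = q" using q(2) m_lcancel[OF pow(2,1)] pc qc by metis
    then show "p \<in> ?P (Suc n)" using q(1) by simp
  qed
  moreover have "?P (Suc n) \<subseteq> ?P n"
    using submodD(4)[OF Ps subsetD[OF JV]] by (auto simp: mem_ideal_prod_iff[OF Js Ps])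
  ultimately have stat: "?P (Suc n) = ?P n" by auto
  have "?P (k + n) = ?P n" for k
    by (induction k) (use stat in auto)
  then have idem: "ideal_prod K (?P n) (?P n) = ?P n"
    using ideal_pow_add[OF Js, of n n] by simp
  have PJ: "?P n \<subseteq> J" using ideal_pow_subset[OF Js JV n(1)] .
  have prime: "primeideal (?P n) (K\<lparr>carrier := V\<rparr>)"
    using idempotent_imp_primeideal[OF Ps _ _ ideal_pow_nonzero[OF Js Jne] idem]
      PJ JM JV one_notin_nonunits by blast
  have P_eq: "?P n = nonunits"
  proof (rule ccontr)
    assume "?P n \<noteq> nonunits"
    with prime ideal_pow_nonzero[OF Js Jne] have "ideal_prod K (?P n) (?P n) \<noteq> ?P n"
      by (intro nonidem[rule_format] conjI)
    then show False using idem by (rule notE)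
  qed
  show "ideal_prod K nonunits nonunits = nonunits" using idem unfolding P_eq .
  have "J = nonunits" using JM PJ unfolding P_eq by (rule equalityI)
  then show "I = x <# nonunits" using I_eq by (rule subst)
qed

lemma ratliff_rush_eq_v_closure:
  assumes nonidem: "\<forall>P. primeideal P (K\<lparr>carrier := V\<rparr>) \<and> P \<noteq> {\<zero>} \<and> P \<noteq> nonunits \<longrightarrow>
      ideal_prod K P P \<noteq> P"
    and I: "I \<in> fractional_ideals V K"
  shows "ratliff_rush V K I = v_closure V K I"
proof (intro equalityI subsetI)
  fix x assume x: "x \<in> ratliff_rush V K I"
  then have xc: "x \<in> carrier K" by (simp add: ratliff_rush_iff)
  show "x \<in> v_closure V K I"
  proof (cases "x \<in> I")
    case True
    then show ?thesis using subset_v_closure[OF fractional_subset_carrier[OF I]] by auto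
  next
    case False
    note new = ratliff_rush_new_element[OF nonidem I x False]
    show ?thesis using mem_v_closure_of_idempotent[OF xc new(2)] new(1) by simp
  qed
next
  fix x assume x: "x \<in> v_closure V K I"
  then have xc: "x \<in> carrier K" by (simp add: v_closure_def frac_inv_iff[of x])
  show "x \<in> ratliff_rush V K I"
  proof (cases "x \<in> I")
    case True
    then show ?thesis using subset_ratliff_rush[of I] I by (auto simp: fractional_ideals_iff)
  next
    case False
    note new = v_closure_new_element[OF I x False]
    show ?thesis using mem_ratliff_rush_of_idempotent[OF xc new(2)] new(1) by simp
  qed
qed


section \<open>Idempotent primes below the maximal ideal\<close>

lemma idempotent_prime_ratliff_rush_not_subset:
  assumes P: "primeideal P (K\<lparr>carrier := V\<rparr>)" and nm: "P \<noteq> nonunits"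
    and idem: "ideal_prod K P P = P"
  shows "\<not> ratliff_rush V K P \<subseteq> V"
proof -
  have s: "submod P" "P \<subseteq> V" and "P \<noteq> V"
    using primeideal.axioms(1)[OF P] primeideal.I_notcarr[OF P] by (auto simp: ideal_iff)
  then have "P \<subseteq> nonunits" using proper_subset_nonunits submod_eq_V by blast
  then obtain m where m: "m \<in> nonunits" "m \<notin> P" using nm by auto
  have mc: "m \<in> carrier K" and mV: "m \<in> V" and m0: "m \<noteq> \<zero>"
    using m submodD(1)[OF submod_nonunits m(1)] nonunits_subset submodD(2)[OF s(1)] by auto
  have "inv m \<otimes> p \<in> P" if p: "p \<in> P" for p
  proof -
    obtain n where n: "n \<in> nonunits" "p = n \<otimes> m" using notin_submod_factor[OF s(1) mc m(2) p] .
    have nV: "n \<in> V" using n(1) nonunits_subset by auto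
    have "n \<in> P" using primeideal.I_prime[OF P, of n m] n(2) nV mV p m(2) by simp
    moreover have "inv m \<otimes> p = n"
      using n(2) inv_mult_cancel(1)[OF mc m0 V_carrier[OF nV]] mc V_carrier[OF nV] by (simp add: m_comm)
    ultimately show ?thesis by simp
  qed
  \<comment> \<open>The exponent is 1, because \<open>m\<^sup>-\<^sup>1P\<close> is contained in \<open>P = P\<^sup>2\<close>.\<close>
  then have "inv m \<in> ratliff_rush V K P"
    using inv_nonzero(1)[OF mc m0] idem
    by (auto simp: ratliff_rush_iff ideal_prod_V[OF s(1)] intro!: exI[of _ 1])
  then show ?thesis using inv_notin_of_nonunit[OF m(1) m0] by auto
qed

lemma star_operation_imp_not_idempotent:
  assumes star: "star_operation V K (ratliff_rush V K)"
    and P: "primeideal P (K\<lparr>carrier := V\<rparr>)" "P \<noteq> {\<zero>}" "P \<noteq> nonunits"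
  shows "ideal_prod K P P \<noteq> P"
proof
  assume idem: "ideal_prod K P P = P"
  have s: "submod P" "P \<subseteq> V" using primeideal.axioms(1)[OF P(1)] by (auto simp: ideal_iff)
  have "P \<in> fractional_ideals V K" using integral_submod_fractional[OF s(1) P(2) s(2)] .
  from bspec[OF bspec[OF star_operationD(5)[OF star] this] V_fractional]
  have "ratliff_rush V K P \<subseteq> V" using s(2) star_operationD(2)[OF star] by simp
  then show False using idempotent_prime_ratliff_rush_not_subset[OF P(1,3) idem] by simp
qed

end

theorem theorem3p5:
  fixes K :: "('a, 'b) ring_scheme" and V :: "'a set"
  assumes "valuation_domain V K"
  defines "R \<equiv> K\<lparr>carrier := V\<rparr>"
  shows "(star_operation V K (ratliff_rush V K) \<longleftrightarrow>
            (\<forall>P. primeideal P R \<and> P \<noteq> {\<zero>\<^bsub>R\<^esub>} \<and> \<not> maximalideal P R \<longrightarrow> P \<cdot>\<^bsub>R\<^esub> P \<noteq> P)) \<and>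
         (star_operation V K (ratliff_rush V K) \<longrightarrow>
            (\<forall>I \<in> fractional_ideals V K. ratliff_rush V K I = v_closure V K I))"
proof -
  interpret valuation_domain V K by (rule assms(1))
  let ?nonidem = "\<forall>P. primeideal P R \<and> P \<noteq> {\<zero>\<^bsub>R\<^esub>} \<and> \<not> maximalideal P R \<longrightarrow> P \<cdot>\<^bsub>R\<^esub> P \<noteq> P"
  have nonidem: "?nonidem \<longleftrightarrow> (\<forall>P. primeideal P (K\<lparr>carrier := V\<rparr>) \<and> P \<noteq> {\<zero>\<^bsub>K\<^esub>} \<and> P \<noteq> nonunits
      \<longrightarrow> ideal_prod K P P \<noteq> P)"
    unfolding R_def maximalideal_iff ideal_prod_subring by simp
  have eq: "ratliff_rush V K I = v_closure V K I"
    if ?nonidem "I \<in> fractional_ideals V K" for I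
    using ratliff_rush_eq_v_closure[OF that(1)[unfolded nonidem] that(2)] .
  have "star_operation V K (ratliff_rush V K) \<longleftrightarrow> ?nonidem"
    using star_operation_imp_not_idempotent
      star_operation_cong[OF eq v_closure_star_operation] unfolding nonidem by blast
  then show ?thesis using eq by blast
qed

end
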